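(* For $k=0,1,2,\dots$ let $\mathcal{P}_k=\{x\in\mathbb{C}_p: f^k(x)=\hat x\}$. 1. $\mathcal{P}_k\neq\emptyset$ for every $k=0,1,2,\dots$. 2. If $\delta<\alpha=\beta$, then $\mathcal{P}_k\subset S_{r_k}(0)$ for every $k=0,1,2,\dots$, where $r_k=\alpha\cdot\left(\frac{\alpha}{\delta}\right)^{1/3^k}$.
   Context: $p$ is a prime, $\mathbb{C}_p$ is the field of complex $p$-adic numbers with norm $|\cdot|_p$, and $a,b\in\mathbb{C}_p$ satisfy $ab\neq 0$. The function $f(x)=\frac{x^3+ax^2+bx}{ax+b}$ is defined for $x\in\mathbb{C}_p$, $x\neq\hat x:=-\frac{b}{a}$, and $f^k$ is its $k$-fold iterate ($f^0=\mathrm{id}$). Let $x_1,x_2=\frac{-a\pm\sqrt{a^2-4b}}{2}$ be the roots of $x^2+ax+b$ in $\mathbb{C}_p$ and put $\delta=|a|_p$, $\alpha=|x_1|_p$, $\beta=|x_2|_p$. $S_r(0)=\{x\in\mathbb{C}_p:|x|_p=r\}$. *)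

theory Defs
  imports "HOL-Analysis.Abstract_Metric_Spaces" "HOL-Computational_Algebra.Computational_Algebra"
begin

definition padic_norm :: "nat \<Rightarrow> rat \<Rightarrow> real" where
  "padic_norm p q =
     (if q = 0 then 0
      else real p powi (int (multiplicity (int p) (snd (quotient_of q)))
                      - int (multiplicity (int p) (fst (quotient_of q)))))"

text \<open>The type class \<open>real_normed_field\<close> is not usable for p-adic fields, since it requires a real
  vector space structure; the norm is therefore an explicit parameter.\<close>

locale nonarchimedean_field =
  fixes N :: "'a::field_char_0 \<Rightarrow> real"
  assumes N_nonneg: "0 \<le> N x"
    and N_eq_0_iff: "N x = 0 \<longleftrightarrow> x = 0"
    and N_mult: "N (x * y) = N x * N y"
    and N_ultrametric: "N (x + y) \<le> max (N x) (N y)"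
begin

lemma N_one: "N 1 = 1"
  using N_mult[of 1 1] N_eq_0_iff[of 1] by simp

lemma N_minus: "N (- x) = N x"
proof -
  have "N (-1) * N (-1) = 1"
    using N_mult[of "-1" "-1"] N_one by simp
  then have "N (-1) = 1"
    using N_nonneg[of "-1"] by (simp add: square_eq_1_iff)
  then show ?thesis
    using N_mult[of "-1" x] by simp
qed

lemma N_triangle: "N (x - z) \<le> N (x - y) + N (y - z)"
  using N_ultrametric[of "x - y" "y - z"] N_nonneg[of "x - y"] N_nonneg[of "y - z"]
  by (simp add: max_def split: if_splits)

end

sublocale nonarchimedean_field \<subseteq> Metric_space UNIV "\<lambda>x y. N (x - y)"
proof
  show "N (x - y) = N (y - x)" for x y
    using N_minus[of "x - y"] by simp
qed (auto simp: N_nonneg N_eq_0_iff N_triangle)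

text \<open>The closure of the rationals; in a complete field whose norm extends the p-adic one this is the
  field of p-adic numbers.\<close>

definition (in nonarchimedean_field) Qp :: "'a set" where
  "Qp = mtopology closure_of (range of_rat)"

definition (in nonarchimedean_field) Qp_alg :: "'a set" where
  "Qp_alg = {x. \<exists>h. h \<noteq> 0 \<and> set (coeffs h) \<subseteq> Qp \<and> poly h x = 0}"

text \<open>The field of complex p-adic numbers is the completion of an algebraic closure of the field of
  p-adic numbers, which determines it up to isometric isomorphism.  The locale states that the ambient
  field is such a completion: it is complete, its norm extends the p-adic norm of the rationals, the
  elements algebraic over the p-adic numbers form an algebraically closed field (that is, an
  algebraic closure of the p-adic numbers), and these elements are dense.\<close>

locale complex_padic_field = nonarchimedean_field N
  for N :: "'a::field_char_0 \<Rightarrow> real" +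
  fixes p :: nat
  assumes prime_p: "prime p"
    and N_of_rat: "N (of_rat q) = padic_norm p q"
    and complete: "mcomplete"
    and Qp_alg_closed:
      "set (coeffs h) \<subseteq> Qp_alg \<Longrightarrow> 0 < degree h \<Longrightarrow> \<exists>x\<in>Qp_alg. poly h x = 0"
    and Qp_alg_dense: "mtopology closure_of Qp_alg = UNIV"

definition x_hat :: "'a::field \<Rightarrow> 'a \<Rightarrow> 'a" where
  "x_hat a b = - (b / a)"

definition f :: "'a::field \<Rightarrow> 'a \<Rightarrow> 'a \<Rightarrow> 'a" where
  "f a b x = (x ^ 3 + a * x ^ 2 + b * x) / (a * x + b)"

text \<open>The map is undefined at \<open>x_hat a b\<close>, whereas division in Isabelle is total.  So the k-th iterate
  is defined at \<open>x\<close> only if no earlier iterate equals \<open>x_hat a b\<close>.\<close>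

definition iterate_defined :: "'a::field \<Rightarrow> 'a \<Rightarrow> nat \<Rightarrow> 'a \<Rightarrow> bool" where
  "iterate_defined a b k x \<longleftrightarrow> (\<forall>j<k. (f a b ^^ j) x \<noteq> x_hat a b)"

definition P :: "'a::field \<Rightarrow> 'a \<Rightarrow> nat \<Rightarrow> 'a set" where
  "P a b k = {x. iterate_defined a b k x \<and> (f a b ^^ k) x = x_hat a b}"

definition sphere0 :: "('a \<Rightarrow> real) \<Rightarrow> real \<Rightarrow> 'a set" where
  "sphere0 N r = {x. N x = r}"

end

theory Submission
  imports Defs
begin

text \<open>Preimages under the map are roots of monic cubics, so non-emptiness reduces to algebraic
  closedness of the completion.  A monic polynomial is approximated by monic polynomials over the
  algebraic elements.  If \<open>x\<close> is a root of one of them, then the next one, of degree \<open>d\<close>, splits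
  and has a small value at \<open>x\<close>, hence a root within the \<open>d\<close>-th root of that value; the roots so
  chosen form a Cauchy sequence.  For the radii, \<open>N b = \<alpha>\<^sup>2\<close>, so that on
  \<open>\<alpha> < N x < \<alpha>\<^sup>2 / \<delta>\<close> the map acts on norms by \<open>r \<mapsto> r\<^sup>3 / \<alpha>\<^sup>2\<close>, while all other points are
  mapped to norms at most \<open>\<alpha>\<close> or larger than \<open>\<alpha>\<^sup>2 / \<delta>\<close>.\<close>

section \<open>Ultrametric norms: basic rules, values and roots of polynomials\<close>

context nonarchimedean_field
begin

lemma N_diff_le: "N (x - y) \<le> max (N x) (N y)"
  using N_ultrametric[of x "- y"] by (simp add: N_minus)

lemma N_zero: "N 0 = 0"
  by (simp add: N_eq_0_iff)

lemma N_power: "N (x ^ n) = N x ^ n"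
  by (induction n) (simp_all add: N_one N_mult)

lemma N_divide: "N (x / y) = N x / N y"
proof (cases "y = 0")
  case False
  then have "N x = N (x / y) * N y"
    using N_mult[of "x / y" y] by simp
  moreover have "N y \<noteq> 0"
    using False by (simp add: N_eq_0_iff)
  ultimately show ?thesis
    by simp
qed (simp add: N_zero)

text \<open>Since \<open>x = (x + y) - y\<close>, the norm of \<open>x\<close> is at most the larger
  of \<open>N (x + y)\<close> and \<open>N y\<close>, and \<open>N y\<close> is too small to
  serve.\<close>

lemma N_add_eq_left:
  assumes "N y < N x"
  shows "N (x + y) = N x"
  using N_ultrametric[of x y] N_diff_le[of "x + y" y] assms by (simp add: max_def split: if_splits)

text \<open>Horner induction: sums cost nothing in an ultrametric norm, each multiplication by
  \<open>x\<close> costs a factor \<open>B\<close>, and \<open>1 \<le> B\<close> takes care of the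
  lower terms.\<close>

lemma N_poly_le:
  assumes "\<And>i. N (coeff h i) \<le> c" "degree h \<le> n" "1 \<le> B" "N x \<le> B"
  shows "N (poly h x) \<le> c * B ^ n"
  using assms(1,2)
proof (induction h arbitrary: n)
  case 0
  have "0 \<le> c"
    using 0(1)[of 0] N_nonneg[of 0] by (simp add: N_zero)
  then show ?case
    using assms(3) by (simp add: N_zero)
next
  case (pCons a h)
  have a: "N a \<le> c"
    using pCons.prems(1)[of 0] by simp
  then have c: "0 \<le> c"
    using N_nonneg[of a] by simp
  have h: "N (coeff h i) \<le> c" for i
    using pCons.prems(1)[of "Suc i"] by simp
  have Bn: "1 \<le> B ^ n"
    using assms(3) by simp
  have "N (x * poly h x) \<le> c * B ^ n"
  proof (cases "h = 0")
    case True
    then show ?thesis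
      using c Bn by (simp add: N_zero)
  next
    case False
    then obtain m where m: "n = Suc m" "degree h \<le> m"
      using pCons.prems(2) by (cases n) auto
    have "N x * N (poly h x) \<le> B * (c * B ^ m)"
      using pCons.IH[OF h m(2)] assms(3,4) N_nonneg by (intro mult_mono) auto
    then show ?thesis
      by (simp add: m(1) N_mult mult_ac)
  qed
  moreover have "N a \<le> c * B ^ n"
    using a c Bn mult_left_mono[OF Bn c] by simp
  ultimately show ?case
    using N_ultrametric[of a "x * poly h x"] by simp
qed

text \<open>If \<open>c < N x\<close>, all lower terms together are smaller than the leading power
  of \<open>x\<close>, so they cannot cancel it.\<close>

lemma N_root_le:
  assumes "lead_coeff h = 1" "poly h x = 0" "\<And>i. N (coeff h i) \<le> c" "1 \<le> c"
  shows "N x \<le> c"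
proof (rule ccontr)
  assume "\<not> N x \<le> c"
  then have x: "c < N x"
    by simp
  have "degree h \<noteq> 0"
  proof
    assume "degree h = 0"
    then obtain a where "h = [:a:]"
      using degree0_coeffs by blast
    then show False
      using assms(1,2) by simp
  qed
  then obtain n where n: "degree h = Suc n"
    using not0_implies_Suc by blast
  let ?q = "h - monom 1 (Suc n)"
  have q0: "coeff ?q (Suc n) = 0"
    using assms(1) n by simp
  have dq: "degree ?q \<le> n"
  proof (rule degree_le, intro allI impI)
    fix i
    assume "n < i"
    then show "coeff ?q i = 0"
      using q0 n coeff_eq_0[of h i] by (cases "i = Suc n") auto
  qed
  have "N (coeff ?q i) \<le> c" for i
    using assms(3)[of i] q0 assms(4) by (cases "i = Suc n") (auto simp: N_zero)
  then have "N (poly ?q x) \<le> c * N x ^ n"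
    using dq x assms(4) by (intro N_poly_le) auto
  moreover have "poly ?q x = - (x ^ Suc n)"
    using assms(2) by (simp add: poly_monom)
  ultimately have "N x ^ Suc n \<le> c * N x ^ n"
    by (simp only: N_minus N_power)
  moreover have "c * N x ^ n < N x * N x ^ n"
    using x assms(4) by (intro mult_strict_right_mono) auto
  ultimately show False
    by simp
qed

lemma tendsto_N_poly:
  assumes "(\<lambda>n. N (x n - l)) \<longlonglongrightarrow> 0"
  shows "(\<lambda>n. N (poly g (x n) - poly g l)) \<longlonglongrightarrow> 0"
proof (induction g)
  case 0
  then show ?case
    by (simp add: N_zero)
next
  case (pCons a g)
  let ?d = "\<lambda>n. N (poly g (x n) - poly g l)"
  \<comment> \<open>A majorant obtained as in the product rule; the norm of
    \<open>poly g (x n)\<close> is itself bounded through \<open>poly g l\<close>.\<close>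
  let ?u = "\<lambda>n. N (x n - l) * (?d n + N (poly g l)) + N l * ?d n"
  have "?u \<longlonglongrightarrow> 0 * (0 + N (poly g l)) + N l * 0"
    by (intro tendsto_intros assms pCons.IH)
  then have u: "?u \<longlonglongrightarrow> 0"
    by simp
  have "N (poly (pCons a g) (x n) - poly (pCons a g) l) \<le> ?u n" for n
  proof -
    have "poly (pCons a g) (x n) - poly (pCons a g) l =
        (x n - l) * poly g (x n) + l * (poly g (x n) - poly g l)"
      by (simp add: algebra_simps)
    then have "N (poly (pCons a g) (x n) - poly (pCons a g) l) \<le>
        max (N (x n - l) * N (poly g (x n))) (N l * ?d n)"
      by (metis N_mult N_ultrametric)
    moreover have "N (poly g (x n)) \<le> ?d n + N (poly g l)"
      using N_ultrametric[of "poly g (x n) - poly g l" "poly g l"] N_nonneg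
      by (smt (verit) diff_add_cancel)
    then have "N (x n - l) * N (poly g (x n)) \<le> N (x n - l) * (?d n + N (poly g l))"
      using N_nonneg by (intro mult_left_mono)
    ultimately show ?thesis
      using N_nonneg[of "x n - l"] N_nonneg[of l] N_nonneg[of "poly g (x n) - poly g l"]
        N_nonneg[of "poly g l"]
      by (smt (verit) mult_nonneg_nonneg)
  qed
  then show ?case
    by (intro tendsto_sandwich[OF _ _ tendsto_const u]) (auto simp: N_nonneg)
qed

section \<open>The closure of the rationals and the elements algebraic over it\<close>

lemma in_closure_iff: "x \<in> mtopology closure_of S \<longleftrightarrow> (\<forall>e>0. \<exists>y\<in>S. N (x - y) < e)"
  by (auto simp: metric_closure_of)

lemma Qp_iff: "x \<in> Qp \<longleftrightarrow> (\<forall>e>0. \<exists>q. N (x - of_rat q) < e)"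
  by (auto simp: Qp_def in_closure_iff)

lemma of_rat_in_Qp: "of_rat q \<in> Qp"
  unfolding Qp_iff using N_zero by (metis diff_self)

lemma Qp_0: "0 \<in> Qp" and Qp_1: "1 \<in> Qp"
  using of_rat_in_Qp[of 0] of_rat_in_Qp[of 1] by simp_all

lemma Qp_diff:
  assumes "x \<in> Qp" "y \<in> Qp"
  shows "x - y \<in> Qp"
  unfolding Qp_iff
proof (intro allI impI)
  fix e :: real
  assume "0 < e"
  then obtain q r where "N (x - of_rat q) < e" "N (y - of_rat r) < e"
    using assms by (meson Qp_iff)
  then have "N ((x - of_rat q) - (y - of_rat r)) < e"
    using N_diff_le by (meson le_less_trans max_less_iff_conj)
  moreover have "(x - of_rat q) - (y - of_rat r) = (x - y) - of_rat (q - r)"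
    by (simp add: of_rat_diff)
  ultimately show "\<exists>q. N (x - y - of_rat q) < e"
    by metis
qed

lemma Qp_minus: "x \<in> Qp \<Longrightarrow> - x \<in> Qp"
  using Qp_diff[OF Qp_0] by simp

lemma Qp_add: "x \<in> Qp \<Longrightarrow> y \<in> Qp \<Longrightarrow> x + y \<in> Qp"
  using Qp_diff[of x "- y"] Qp_minus by simp

text \<open>If \<open>x\<close> is a root of \<open>h\<close>, then \<open>x + 1\<close> is a root
  of this composition. Multiplying by \<open>[:-1, 1:]\<close> only shifts and subtracts
  coefficients, so closure of \<open>Qp\<close> under sums and differences suffices.\<close>

lemma coeff_Qp_shift:
  assumes "\<And>i. coeff h i \<in> Qp"
  shows "coeff (pcompose h [:-1, 1:]) i \<in> Qp"
  using assms
proof (induction h arbitrary: i)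
  case 0
  then show ?case by simp
next
  case (pCons a h)
  have "coeff h i \<in> Qp" for i
    using pCons.prems[of "Suc i"] by simp
  then have IH: "coeff (pcompose h [:-1, 1:]) i \<in> Qp" for i
    using pCons.IH by simp
  have "a \<in> Qp"
    using pCons.prems[of 0] by simp
  then show ?case
    using IH[of 0] IH by (cases i) (auto simp: pcompose_pCons coeff_pCons intro!: Qp_add Qp_diff Qp_minus)
qed

text \<open>\<open>range (coeff h)\<close> exceeds \<open>set (coeffs h)\<close> at most by 0, which
  lies in \<open>Qp\<close>. Quantifying over all indices suits inductions along
  \<open>pCons\<close>.\<close>

lemma Qp_alg_iff: "x \<in> Qp_alg \<longleftrightarrow> (\<exists>h. h \<noteq> 0 \<and> (\<forall>i. coeff h i \<in> Qp) \<and> poly h x = 0)"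
proof -
  have "set (coeffs h) \<subseteq> Qp \<longleftrightarrow> (\<forall>i. coeff h i \<in> Qp)" for h
  proof -
    have "set (coeffs h) \<subseteq> Qp \<longleftrightarrow> range (coeff h) \<subseteq> Qp"
      unfolding range_coeff using Qp_0 by simp
    then show ?thesis
      by (simp add: image_subset_iff)
  qed
  then show ?thesis
    by (simp add: Qp_alg_def)
qed

lemma Qp_subset_Qp_alg: "Qp \<subseteq> Qp_alg"
proof
  fix x
  assume "x \<in> Qp"
  then have "\<forall>i. coeff [:-x, 1:] i \<in> Qp"
    by (auto simp: coeff_pCons Qp_0 Qp_1 Qp_minus split: nat.split)
  then show "x \<in> Qp_alg"
    unfolding Qp_alg_iff by (intro exI[of _ "[:-x, 1:]"]) simp
qed

lemma Qp_alg_plus_1: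
  assumes "x \<in> Qp_alg"
  shows "x + 1 \<in> Qp_alg"
proof -
  obtain h where h: "h \<noteq> 0" "\<forall>i. coeff h i \<in> Qp" "poly h x = 0"
    using assms by (auto simp: Qp_alg_iff)
  moreover have "pcompose h [:-1, 1:] \<noteq> 0"
    using h(1) by (simp add: pcompose_eq_0_iff)
  ultimately show ?thesis
    unfolding Qp_alg_iff using coeff_Qp_shift[of h]
    by (intro exI[of _ "pcompose h [:-1, 1:]"]) (simp add: poly_pcompose)
qed

end

section \<open>Field operations on the algebraic elements\<close>

context complex_padic_field
begin

lemma Qp_alg_0: "0 \<in> Qp_alg" and Qp_alg_1: "1 \<in> Qp_alg"
  using Qp_subset_Qp_alg Qp_0 Qp_1 by auto

text \<open>Algebraic closedness is applied to a linear polynomial: this makes the algebraic elements a field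
  without resultants or dimension arguments, since \<open>x + y = (x / y + 1) * y\<close>.\<close>

lemma Qp_alg_minus_divide:
  assumes "x \<in> Qp_alg" "y \<in> Qp_alg" "y \<noteq> 0"
  shows "- (x / y) \<in> Qp_alg"
proof -
  have "set (coeffs [:x, y:]) \<subseteq> Qp_alg"
    using assms by (auto simp: cCons_def)
  then obtain z where "z \<in> Qp_alg" "poly [:x, y:] z = 0"
    using Qp_alg_closed[of "[:x, y:]"] assms(3) by auto
  moreover from this have "z = - (x / y)"
    using assms(3) by (simp add: field_simps add_eq_0_iff)
  ultimately show ?thesis
    by simp
qed

lemma Qp_alg_uminus: "x \<in> Qp_alg \<Longrightarrow> - x \<in> Qp_alg"
  using Qp_alg_minus_divide[OF _ Qp_alg_1] by simp

lemma Qp_alg_divide: "x \<in> Qp_alg \<Longrightarrow> y \<in> Qp_alg \<Longrightarrow> x / y \<in> Qp_alg"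
  using Qp_alg_minus_divide[of "- x" y] Qp_alg_uminus Qp_alg_0 by (cases "y = 0") auto

lemma Qp_alg_mult: "x \<in> Qp_alg \<Longrightarrow> y \<in> Qp_alg \<Longrightarrow> x * y \<in> Qp_alg"
  using Qp_alg_divide[of x "1 / y"] Qp_alg_divide[OF Qp_alg_1, of y] by simp

lemma Qp_alg_add:
  assumes "x \<in> Qp_alg" "y \<in> Qp_alg"
  shows "x + y \<in> Qp_alg"
proof (cases "y = 0")
  case False
  have "(x / y + 1) * y \<in> Qp_alg"
    using assms by (intro Qp_alg_mult Qp_alg_plus_1 Qp_alg_divide)
  moreover have "(x / y + 1) * y = x + y"
    using False by (simp add: distrib_right)
  ultimately show ?thesis
    by simp
qed (use assms in simp)

lemma poly_in_Qp_alg: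
  assumes "\<And>i. coeff h i \<in> Qp_alg" "x \<in> Qp_alg"
  shows "poly h x \<in> Qp_alg"
  using assms(1)
proof (induction h)
  case 0
  then show ?case by (simp add: Qp_alg_0)
next
  case (pCons a h)
  have "coeff h i \<in> Qp_alg" for i
    using pCons.prems[of "Suc i"] by simp
  moreover have "a \<in> Qp_alg"
    using pCons.prems[of 0] by simp
  ultimately show ?case
    using pCons.IH assms(2) by (simp add: Qp_alg_add Qp_alg_mult)
qed

text \<open>The coefficients of the quotient are values at \<open>x\<close> of the successive Horner
  tails of \<open>h\<close>. Hence a root can be split off without leaving
  \<open>Qp_alg\<close>.\<close>

lemma coeff_synthetic_div_in_Qp_alg:
  assumes "\<And>i. coeff h i \<in> Qp_alg" "x \<in> Qp_alg"
  shows "coeff (synthetic_div h x) i \<in> Qp_alg"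
  using assms(1)
proof (induction h arbitrary: i)
  case 0
  then show ?case by (simp add: Qp_alg_0)
next
  case (pCons a h)
  have "coeff h i \<in> Qp_alg" for i
    using pCons.prems[of "Suc i"] by simp
  then show ?case
    using pCons.IH poly_in_Qp_alg[OF _ assms(2)] by (simp add: coeff_pCons split: nat.split)
qed

section \<open>Roots of monic polynomials over the complete field\<close>

text \<open>For monic \<open>h\<close>, \<open>N (poly h x)\<close> is the product of the distances
  from \<open>x\<close> to the roots of \<open>h\<close>, so it bounds the
  \<open>degree h\<close>-th power of the smallest distance. The point \<open>x\<close> need not be
  algebraic.\<close>

lemma Qp_alg_near_root:
  assumes "\<And>i. coeff h i \<in> Qp_alg" "lead_coeff h = 1" "0 < degree h"
  shows "\<exists>r\<in>Qp_alg. poly h r = 0 \<and> N (x - r) ^ degree h \<le> N (poly h x)"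
  using assms
proof (induction "degree h" arbitrary: h)
  case 0
  then show ?case by simp
next
  case (Suc n)
  have "set (coeffs h) \<subseteq> Qp_alg"
  proof -
    have "range (coeff h) \<subseteq> Qp_alg"
      using Suc.prems(1) by (simp add: image_subset_iff)
    then show ?thesis
      unfolding range_coeff by simp
  qed
  then obtain r where r: "r \<in> Qp_alg" "poly h r = 0"
    using Qp_alg_closed Suc.prems(3) by blast
  define q where "q = synthetic_div h r"
  have h: "h = [:- r, 1:] * q"
    using synthetic_div_correct'[of r h] r(2) by (simp add: q_def)
  have dq: "degree q = n"
    using Suc.hyps(2) by (simp add: q_def degree_synthetic_div)
  have mq: "lead_coeff q = 1"
    using Suc.prems(2) unfolding h lead_coeff_mult by simp
  have cq: "coeff q i \<in> Qp_alg" for i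
    unfolding q_def using Suc.prems(1) r(1) by (rule coeff_synthetic_div_in_Qp_alg)
  have val: "N (poly h x) = N (x - r) * N (poly q x)"
    by (simp add: h N_mult[symmetric] algebra_simps)
  \<comment> \<open>The nearer of \<open>r\<close> and the root supplied by induction for
    \<open>q\<close> is kept; if that is \<open>r\<close>, it inherits the power bound.\<close>
  have root: "\<exists>t\<in>Qp_alg. poly h t = 0 \<and> N (x - t) \<le> N (x - r) \<and> N (x - t) ^ n \<le> N (poly q x)"
  proof (cases "n = 0")
    case True
    then obtain c where "q = [:c:]"
      using dq degree0_coeffs by blast
    then have "q = 1"
      using mq by (simp add: one_pCons)
    then show ?thesis
      using r True by (auto simp: N_one)
  next
    case False
    then obtain t where t: "t \<in> Qp_alg" "poly q t = 0" "N (x - t) ^ n \<le> N (poly q x)"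
      using Suc.hyps(1)[OF dq[symmetric] cq mq] dq by auto
    show ?thesis
    proof (cases "N (x - t) \<le> N (x - r)")
      case True
      then show ?thesis
        using t by (auto simp: h)
    next
      case False
      then have "N (x - r) ^ n \<le> N (x - t) ^ n"
        using N_nonneg by (intro power_mono) auto
      then show ?thesis
        using t(3) r by force
    qed
  qed
  then obtain t where t: "t \<in> Qp_alg" "poly h t = 0" "N (x - t) \<le> N (x - r)"
    "N (x - t) ^ n \<le> N (poly q x)"
    by blast
  have "N (x - t) ^ Suc n \<le> N (x - r) * N (poly q x)"
    unfolding power_Suc using t(3,4) N_nonneg by (intro mult_mono) auto
  then show ?case
    using t(1,2) val Suc.hyps(2) by auto
qed

lemma Qp_alg_approx_poly:
  assumes "lead_coeff g = 1" "0 < e"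
  shows "\<exists>h. degree h = degree g \<and> lead_coeff h = 1 \<and>
    (\<forall>i. coeff h i \<in> Qp_alg \<and> N (coeff g i - coeff h i) < e)"
proof -
  have "\<exists>c\<in>Qp_alg. N (x - c) < e" for x
    using Qp_alg_dense in_closure_iff[of x Qp_alg] assms(2) by auto
  then obtain c where c: "\<And>x. c x \<in> Qp_alg" "\<And>x. N (x - c x) < e"
    by metis
  \<comment> \<open>Only coefficients below the degree are perturbed, which keeps the polynomial
    monic of the same degree.\<close>
  define u where "u i = (if i < degree g then c (coeff g i) else coeff g i)" for i
  define h where "h = Abs_poly u"
  have "u i = 0" if "degree g < i" for i
    using that by (simp add: u_def coeff_eq_0)
  then have h: "coeff h i = u i" for i
    unfolding h_def by (simp add: coeff_Abs_poly[of "degree g"])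
  have "degree h = degree g"
  proof (rule antisym)
    show "degree h \<le> degree g"
      by (rule degree_le) (simp add: h u_def coeff_eq_0)
    show "degree g \<le> degree h"
      using assms(1) by (intro le_degree) (simp add: h u_def)
  qed
  moreover from this have "lead_coeff h = 1"
    using assms(1) by (simp add: h u_def)
  moreover have "coeff h i \<in> Qp_alg" for i
    using c(1) assms(1) Qp_alg_0 Qp_alg_1 coeff_eq_0[of g i]
    by (cases i "degree g" rule: linorder_cases) (auto simp: h u_def)
  moreover have "N (coeff g i - coeff h i) < e" for i
    using c(2) assms(2) by (simp add: h u_def N_zero)
  ultimately show ?thesis
    by blast
qed

lemma monic_has_root:
  fixes g :: "'a poly"
  assumes "lead_coeff g = 1" "0 < degree g"
  shows "\<exists>x. poly g x = 0"
proof -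
  define d where "d = degree g"
  have d: "0 < d"
    using assms(2) by (simp add: d_def)
  \<comment> \<open>A \<open>d\<close>-th power, because the next root is found within the
    \<open>d\<close>-th root of an error of this size; the distances then decrease
    geometrically.\<close>
  define e :: "nat \<Rightarrow> real" where "e n = ((1/2) ^ n) ^ d" for n
  have e: "0 < e n" "e n \<le> 1" for n
    by (auto simp: e_def power_le_one)
  have e_Suc: "e (Suc n) \<le> e n" for n
    unfolding e_def by (intro power_mono) auto
  have "\<forall>n. \<exists>h. degree h = d \<and> lead_coeff h = 1 \<and>
      (\<forall>i. coeff h i \<in> Qp_alg \<and> N (coeff g i - coeff h i) < e n)"
    unfolding d_def using Qp_alg_approx_poly[OF assms(1)] e(1) by blast
  then obtain h where h: "\<And>n. degree (h n) = d" "\<And>n. lead_coeff (h n) = 1"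
    "\<And>n i. coeff (h n) i \<in> Qp_alg" "\<And>n i. N (coeff g i - coeff (h n) i) < e n"
    by metis
  \<comment> \<open>One bound for the coefficients of \<open>g\<close> and of every
    \<open>h n\<close>, hence for all their roots; 1 is inserted because the root bound requires
    \<open>1 \<le> M\<close>.\<close>
  define M where "M = Max (insert 1 ((\<lambda>i. N (coeff g i)) ` {..d}))"
  have M1: "1 \<le> M"
    by (simp add: M_def)
  have Mg: "N (coeff g i) \<le> M" for i
  proof (cases "i \<le> d")
    case True
    then show ?thesis
      unfolding M_def by (intro Max_ge) auto
  next
    case False
    then show ?thesis
      using M1 by (simp add: d_def coeff_eq_0 N_zero)
  qed
  have Mh: "N (coeff (h n) i) \<le> M" for n i
  proof -
    have "N (coeff (h n) i) \<le> max (N (coeff g i)) (N (coeff g i - coeff (h n) i))"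
      using N_diff_le[of "coeff g i" "coeff g i - coeff (h n) i"] by simp
    moreover have "N (coeff g i - coeff (h n) i) \<le> M"
      using h(4)[where n = n and i = i] e(2)[of n] M1 by linarith
    ultimately show ?thesis
      using Mg[of i] by linarith
  qed
  have Mx: "N x \<le> M" if "poly (h n) x = 0" for n x
    using N_root_le[OF h(2) that Mh M1] .
  have step: "\<exists>y. poly (h (Suc n)) y = 0 \<and> N (x - y) \<le> M * (1/2) ^ n"
    if x: "poly (h n) x = 0" for n x
  proof -
    obtain y where y: "poly (h (Suc n)) y = 0" "N (x - y) ^ d \<le> N (poly (h (Suc n)) x)"
      using Qp_alg_near_root[OF h(3) h(2), of "Suc n" x] h(1) d by auto
    \<comment> \<open>Since \<open>h n\<close> vanishes at \<open>x\<close>, the value of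
      \<open>h (Suc n)\<close> there equals that of the difference, whose coefficients are
      small.\<close>
    let ?q = "h (Suc n) - h n"
    have "N (coeff ?q i) \<le> e n" for i
    proof -
      have "coeff ?q i = (coeff g i - coeff (h n) i) - (coeff g i - coeff (h (Suc n)) i)"
        by simp
      then show ?thesis
        using N_diff_le[of "coeff g i - coeff (h n) i" "coeff g i - coeff (h (Suc n)) i"]
          h(4)[where n = n and i = i] h(4)[where n = "Suc n" and i = i] e_Suc[of n] by auto
    qed
    then have "N (poly ?q x) \<le> e n * M ^ d"
      using h(1) M1 Mx[OF x] by (intro N_poly_le degree_diff_le) auto
    then have "N (x - y) ^ d \<le> (M * (1/2) ^ n) ^ d"
      using y(2) x by (simp add: e_def power_mult_distrib mult.commute)
    then have "N (x - y) \<le> M * (1/2) ^ n"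
      using d M1 by (subst (asm) power_mono_iff) (auto simp: N_nonneg)
    then show ?thesis
      using y(1) by blast
  qed
  have "\<exists>x. \<forall>n. poly (h n) (x n) = 0 \<and> N (x n - x (Suc n)) \<le> M * (1/2) ^ n"
  proof (rule dependent_nat_choice)
    show "\<exists>x. poly (h 0) x = 0"
      using Qp_alg_near_root[OF h(3) h(2), of 0 0] h(1) d by auto
  qed (use step in blast)
  then obtain x where x: "\<And>n. poly (h n) (x n) = 0" "\<And>n. N (x n - x (Suc n)) \<le> M * (1/2) ^ n"
    by blast
  \<comment> \<open>By the ultrametric inequality the largest single step bounds the whole path, so
    no geometric series is summed.\<close>
  have dist: "N (x n - x (n + k)) \<le> M * (1/2) ^ n" for n k
  proof (induction k)
    case 0
    then show ?case using M1 by (simp add: N_zero)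
  next
    case (Suc k)
    have "(1/2 :: real) ^ (n + k) \<le> (1/2) ^ n"
      by (intro power_decreasing) auto
    then have "M * (1/2) ^ (n + k) \<le> M * (1/2) ^ n"
      using M1 by (intro mult_left_mono) auto
    then have "N (x (n + k) - x (Suc (n + k))) \<le> M * (1/2) ^ n"
      using x(2)[of "n + k"] by linarith
    then show ?case
      using Suc N_ultrametric[of "x n - x (n + k)" "x (n + k) - x (Suc (n + k))"] by simp
  qed
  have lim: "(\<lambda>n. M * (1/2 :: real) ^ n) \<longlonglongrightarrow> 0"
    by (intro tendsto_mult_right_zero LIMSEQ_realpow_zero) auto
  have "MCauchy x"
    unfolding MCauchy_def
  proof (intro conjI allI impI)
    fix \<epsilon> :: real
    assume "0 < \<epsilon>"
    then obtain K where K: "M * (1/2) ^ K < \<epsilon>"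
      using order_tendstoD(2)[OF lim] by (auto simp: eventually_sequentially)
    have "N (x m - x n) < \<epsilon>" if "K \<le> m" "K \<le> n" for m n
    proof -
      have "N (x K - x m) \<le> M * (1/2) ^ K" "N (x K - x n) \<le> M * (1/2) ^ K"
        using dist[of K "m - K"] dist[of K "n - K"] that by auto
      then show ?thesis
        using N_diff_le[of "x K - x n" "x K - x m"] K by simp
    qed
    then show "\<exists>K. \<forall>m n. K \<le> m \<longrightarrow> K \<le> n \<longrightarrow> N (x m - x n) < \<epsilon>"
      by blast
  qed simp
  then obtain l where "limitin mtopology x l sequentially"
    using complete by (auto simp: mcomplete_def)
  then have "(\<lambda>n. N (x n - l)) \<longlonglongrightarrow> 0"
    by (simp add: limitin_metric_dist_null)
  then have gl: "(\<lambda>n. N (poly g (x n) - poly g l)) \<longlonglongrightarrow> 0"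
    by (rule tendsto_N_poly)
  \<comment> \<open>As \<open>x n\<close> is a root of \<open>h n\<close>, the value of
    \<open>g\<close> at \<open>x n\<close> is that of \<open>g - h n\<close>.\<close>
  have "N (poly g (x n)) \<le> M ^ d * (1/2) ^ n" for n
  proof -
    have "N (poly (g - h n) (x n)) \<le> e n * M ^ d"
      using h(4)[where n = n] h(1) M1 Mx[OF x(1)]
      by (intro N_poly_le degree_diff_le) (auto simp: d_def less_imp_le)
    moreover have "((1/2 :: real) ^ n) ^ d \<le> (1/2) ^ n"
      using d power_decreasing[of 1 d "(1/2 :: real) ^ n"] by (simp add: power_le_one)
    then have "e n * M ^ d \<le> M ^ d * (1/2) ^ n"
      using M1 by (simp add: e_def)
    ultimately show ?thesis
      using x(1)[of n] by simp
  qed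
  moreover have "N (poly g l) \<le> N (poly g (x n)) + N (poly g (x n) - poly g l)" for n
  proof -
    have "N (poly g l) \<le> max (N (poly g (x n))) (N (poly g (x n) - poly g l))"
      using N_diff_le[of "poly g (x n)" "poly g (x n) - poly g l"] by simp
    then show ?thesis
      using N_nonneg[of "poly g (x n)"] N_nonneg[of "poly g (x n) - poly g l"] by linarith
  qed
  ultimately have le: "N (poly g l) \<le> M ^ d * (1/2) ^ n + N (poly g (x n) - poly g l)" for n
    by (meson add_right_mono order_trans)
  have "(\<lambda>n. M ^ d * (1/2 :: real) ^ n) \<longlonglongrightarrow> 0"
    by (intro tendsto_mult_right_zero LIMSEQ_realpow_zero) auto
  from tendsto_add[OF this gl]
  have "(\<lambda>n. M ^ d * (1/2 :: real) ^ n + N (poly g (x n) - poly g l)) \<longlonglongrightarrow> 0 + 0" .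
  then have "N (poly g l) \<le> 0 + 0"
    by (rule tendsto_lowerbound) (auto intro: always_eventually le)
  then have "poly g l = 0"
    using N_nonneg[of "poly g l"] N_eq_0_iff by simp
  then show ?thesis
    by blast
qed

section \<open>Preimages under the map and non-emptiness\<close>

lemma f_preimage:
  fixes a b y :: 'a
  assumes "a \<noteq> 0" "b \<noteq> 0"
  shows "\<exists>x. x \<noteq> x_hat a b \<and> f a b x = y"
proof -
  let ?g = "[:- (y * b), b - y * a, a, 1:]"
  obtain x where x: "poly ?g x = 0"
    using monic_has_root[of ?g] by auto
  have eq: "x ^ 3 + a * x ^ 2 + b * x = y * (a * x + b)"
  proof -
    have "poly ?g x = x ^ 3 + a * x ^ 2 + b * x - y * (a * x + b)"
      by (simp add: algebra_simps power2_eq_square power3_eq_cube)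
    then show ?thesis using x by simp
  qed
  \<comment> \<open>At the pole the cubic equation collapses to \<open>x ^ 3 = 0\<close>, which
    would force \<open>b = 0\<close>.\<close>
  have nz: "a * x + b \<noteq> 0"
  proof
    assume 0: "a * x + b = 0"
    have "x ^ 3 + x * (a * x + b) = y * (a * x + b)"
      using eq by (simp add: algebra_simps power2_eq_square)
    then have "x = 0"
      unfolding 0 by simp
    then show False
      using 0 assms(2) by simp
  qed
  then have "f a b x = y"
    using eq by (simp add: f_def)
  moreover have "x \<noteq> x_hat a b"
    using nz assms(1) by (auto simp: x_hat_def)
  ultimately show ?thesis
    by blast
qed

end

lemma P_0: "P a b 0 = {x_hat a b}"
  by (auto simp: P_def iterate_defined_def)

text \<open>Peels off the first application of the map: index 0 of \<open>iterate_defined\<close>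
  excludes the pole, the other indices shift to \<open>f a b x\<close>.\<close>

lemma P_Suc: "x \<in> P a b (Suc k) \<longleftrightarrow> x \<noteq> x_hat a b \<and> f a b x \<in> P a b k"
  by (simp add: P_def iterate_defined_def All_less_Suc2 funpow_swap1)

lemma (in complex_padic_field) P_nonempty:
  fixes a b :: 'a
  assumes "a \<noteq> 0" "b \<noteq> 0"
  shows "P a b k \<noteq> {}"
proof (induction k)
  case 0
  then show ?case by (simp add: P_0)
next
  case (Suc k)
  then obtain y where "y \<in> P a b k"
    by blast
  moreover obtain x where "x \<noteq> x_hat a b" "f a b x = y"
    using f_preimage[OF assms] by blast
  ultimately have "x \<in> P a b (Suc k)"
    by (simp add: P_Suc)
  then show ?case
    by blast
qed

section \<open>Norms along backward orbits of the pole\<close>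

text \<open>The upper bound on the image is not strict because the pole, where the backward orbits
  start, has norm exactly \<open>\<alpha>\<^sup>2 / N a\<close>.\<close>

lemma (in nonarchimedean_field) N_f_preimage:
  assumes a: "0 < N a" "N a < \<alpha>" and b: "N b = \<alpha>\<^sup>2"
    and y: "\<alpha> < N (f a b x)" "N (f a b x) \<le> \<alpha>\<^sup>2 / N a"
  shows "N (f a b x) = N x ^ 3 / \<alpha>\<^sup>2"
proof -
  have \<alpha>: "0 < \<alpha>"
    using a by linarith
  have f: "N (f a b x) = N x * N (x\<^sup>2 + (a * x + b)) / N (a * x + b)"
    unfolding f_def by (simp add: N_divide N_mult[symmetric] algebra_simps power2_eq_square
        power3_eq_cube)
  have small: "N (a * x + b) = \<alpha>\<^sup>2" if "N a * N x < \<alpha>\<^sup>2"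
    using N_add_eq_left[of "a * x" b] that b by (simp add: N_mult add.commute)
  \<comment> \<open>On the closed ball of radius \<alpha> the denominator has norm
    \<open>\<alpha>\<^sup>2\<close> and the quadratic factor at most that, so the image stays in the
    ball, against \<open>y(1)\<close>.\<close>
  have "\<alpha> < N x"
  proof (rule ccontr)
    assume "\<not> \<alpha> < N x"
    then have x: "N x \<le> \<alpha>" by simp
    have "N a * N x \<le> N a * \<alpha>"
      using x a by (intro mult_left_mono) auto
    also have "\<dots> < \<alpha>\<^sup>2"
      using a \<alpha> by (simp add: power2_eq_square)
    finally have ab: "N (a * x + b) = \<alpha>\<^sup>2"
      by (rule small)
    have "N (x\<^sup>2) \<le> \<alpha>\<^sup>2"
      using x N_nonneg by (simp add: N_power power_mono)
    then have "N (x\<^sup>2 + (a * x + b)) \<le> \<alpha>\<^sup>2"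
      using N_ultrametric[of "x\<^sup>2" "a * x + b"] ab by simp
    then have "N x * N (x\<^sup>2 + (a * x + b)) \<le> \<alpha> * \<alpha>\<^sup>2"
      using x \<alpha> N_nonneg by (intro mult_mono) auto
    then have "N (f a b x) \<le> \<alpha>"
      unfolding f ab using \<alpha> by (simp add: pos_divide_le_eq)
    then show False
      using y(1) by simp
  qed
  note x = this
  \<comment> \<open>Beyond radius \<alpha> the square dominates both \<open>a * x\<close> and
    \<open>b\<close>, so the numerator of the map has norm \<open>N x ^ 3\<close>.\<close>
  have "N (a * x + b) \<le> max (N a * N x) (\<alpha>\<^sup>2)"
    using N_ultrametric[of "a * x" b] b by (simp add: N_mult)
  moreover have "N a * N x < (N x)\<^sup>2"
    using a x by (simp add: power2_eq_square)
  moreover have "\<alpha>\<^sup>2 < (N x)\<^sup>2"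
    using x \<alpha> by (intro power_strict_mono) auto
  ultimately have "N (x\<^sup>2 + (a * x + b)) = (N x)\<^sup>2"
    using N_add_eq_left[of "a * x + b" "x\<^sup>2"] by (simp add: N_power)
  then have f: "N (f a b x) = N x ^ 3 / N (a * x + b)"
    unfolding f by (simp add: power2_eq_square power3_eq_cube)
  show ?thesis
  proof (cases "N a * N x < \<alpha>\<^sup>2")
    case True
    then show ?thesis
      using f small by simp
  next
    case False
    \<comment> \<open>Total division would give the image 0 at the pole, which the lower bound
      \<alpha> on its norm rules out.\<close>
    have "0 < N (f a b x)"
      using y \<alpha> by linarith
    then have pos: "0 < N (a * x + b)"
      using f N_nonneg[of "a * x + b"] by (cases "N (a * x + b) = 0") auto
    have le: "N (a * x + b) \<le> N a * N x"
      using N_ultrametric[of "a * x" b] b False by (simp add: N_mult)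
    \<comment> \<open>Far out the map increases the norm, so an image within
      \<open>\<alpha>\<^sup>2 / N a\<close> would put \<open>x\<close> strictly inside that
      radius.\<close>
    have "N x < (N x)\<^sup>2 / N a"
      using a x \<alpha> by (simp add: power2_eq_square field_simps)
    also have "\<dots> = N x ^ 3 / (N a * N x)"
      using x \<alpha> by (simp add: power2_eq_square power3_eq_cube field_simps)
    also have "\<dots> \<le> N (f a b x)"
      unfolding f using le pos N_nonneg by (intro divide_left_mono) auto
    finally have "N x < \<alpha>\<^sup>2 / N a"
      using y(2) by linarith
    then show ?thesis
      using False a by (simp add: field_simps)
  qed
qed

text \<open>The radii start at \<open>N (x_hat a b)\<close> and satisfy
  \<open>r' ^ 3 = \<alpha>\<^sup>2 * r\<close> for consecutive \<open>r\<close>, \<open>r'\<close>.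
  The exponents lie in (0, 1], so each radius meets the bounds of
  \<open>N_f_preimage\<close>.\<close>

lemma (in nonarchimedean_field) N_P:
  assumes a: "0 < N a" "N a < \<alpha>" and b: "N b = \<alpha>\<^sup>2" and x: "x \<in> P a b k"
  shows "N x = \<alpha> * (\<alpha> / N a) powr (1 / 3 ^ k)"
  using x
proof (induction k arbitrary: x)
  case 0
  then show ?case
    using a b by (simp add: P_0 x_hat_def N_minus N_divide power2_eq_square)
next
  case (Suc k)
  let ?t = "\<alpha> / N a"
  have t: "1 < ?t" and \<alpha>: "0 < \<alpha>"
    using a by auto
  let ?u = "?t powr (1 / 3 ^ Suc k)"
  have IH: "N (f a b x) = \<alpha> * ?t powr (1 / 3 ^ k)"
    using Suc by (simp add: P_Suc)
  have "?t powr 0 < ?t powr (1 / 3 ^ k)"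
    using t by (intro powr_less_mono) auto
  then have "1 < ?t powr (1 / 3 ^ k)"
    using t by simp
  then have "\<alpha> < N (f a b x)"
    using IH \<alpha> by simp
  moreover have "?t powr (1 / 3 ^ k) \<le> ?t powr 1"
    using t by (intro powr_mono) auto
  then have "N (f a b x) \<le> \<alpha> * ?t"
    unfolding IH using t \<alpha> by (intro mult_left_mono) auto
  ultimately have "N (f a b x) = N x ^ 3 / \<alpha>\<^sup>2"
    using N_f_preimage[OF a b] by (simp add: power2_eq_square)
  then have "N x ^ 3 = \<alpha> ^ 3 * ?t powr (1 / 3 ^ k)"
    using IH \<alpha> by (simp add: field_simps power2_eq_square power3_eq_cube)
  moreover have "?u ^ 3 = ?t powr (1 / 3 ^ k)"
    using a \<alpha> by (simp add: powr_power)
  ultimately have "N x ^ 3 = (\<alpha> * ?u) ^ 3"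
    by (simp add: power_mult_distrib)
  then show ?case
    using N_nonneg \<alpha> by (subst (asm) power_eq_iff_eq_base) auto
qed

theorem theorem3:
  fixes N :: "'a::field_char_0 \<Rightarrow> real" and p :: nat and a b :: 'a
  assumes "complex_padic_field N p"
    and "a * b \<noteq> 0"
  shows "(\<forall>k. P a b k \<noteq> {}) \<and>
    (\<forall>s x1 x2. s ^ 2 = a ^ 2 - 4 * b \<and> x1 = (- a + s) / 2 \<and> x2 = (- a - s) / 2 \<longrightarrow>
      (let \<delta> = N a; \<alpha> = N x1; \<beta> = N x2
       in \<delta> < \<alpha> \<and> \<alpha> = \<beta> \<longrightarrow>
          (\<forall>k. P a b k \<subseteq> sphere0 N (\<alpha> * (\<alpha> / \<delta>) powr (1 / 3 ^ k)))))"
proof -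
  interpret complex_padic_field N p
    by fact
  have ab: "a \<noteq> 0" "b \<noteq> 0"
    using assms(2) by auto
  have sphere: "P a b k \<subseteq> sphere0 N (N x1 * (N x1 / N a) powr (1 / 3 ^ k))"
    if s: "s ^ 2 = a ^ 2 - 4 * b" "x1 = (- a + s) / 2" "x2 = (- a - s) / 2"
      and N: "N a < N x1" "N x1 = N x2" for s x1 x2 k
  proof -
    \<comment> \<open>Vieta's formula for the constant term; with equal root norms it gives the
      required norm of \<open>b\<close>.\<close>
    have "x1 * x2 = (a ^ 2 - s ^ 2) / 4"
      unfolding s(2,3) by (simp add: power2_eq_square field_simps)
    then have "b = x1 * x2"
      unfolding s(1) by simp
    then have "N b = (N x1)\<^sup>2"
      using N(2) by (simp add: N_mult power2_eq_square)
    moreover have "0 < N a"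
      using ab(1) N_nonneg[of a] N_eq_0_iff[of a] by linarith
    ultimately show ?thesis
      using N_P[OF _ N(1)] unfolding sphere0_def by blast
  qed
  show ?thesis
    unfolding Let_def by (intro conjI allI impI; (elim conjE)?) (rule P_nonempty[OF ab], rule sphere)
qed

end
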